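(* The Eigenvector Method may violate group-coherence for choice. That is, there exists a positive integer $n$ such that the ranking method $\mathbf{A} \mapsto \succeq^{EM}_{\mathbf{A}}$ on $\mathcal{A}^{n \times n}$ induced by the Eigenvector Method does not satisfy group-coherence for choice.
   Context: A pairwise comparison matrix of size $n \times n$ is a matrix $\mathbf{A} = [a_{ij}]$ with all entries positive reals such that $a_{ji} = 1/a_{ij}$ for all $1 \leq i,j \leq n$; $\mathcal{A}^{n \times n}$ denotes the set of all of them. The indices $1,\dots,n$ are called alternatives. Eigenvector Method ($EM$): for $\mathbf{A} \in \mathcal{A}^{n \times n}$, $\mathbf{w}^{EM}(\mathbf{A})$ is the vector with positive entries summing to $1$ such that $\mathbf{A}\mathbf{w}^{EM}(\mathbf{A}) = \lambda_{\max}(\mathbf{A}) \mathbf{w}^{EM}(\mathbf{A})$, where $\lambda_{\max}(\mathbf{A})$ is the maximal (Perron) eigenvalue of $\mathbf{A}$. A ranking of the alternatives is a complete, reflexive and transitive binary relation $\succeq$ on $\{1,\dots,n\}$; its strict part is $i \succ j$ iff $i \succeq j$ and not $j \succeq i$. A ranking method $g$ assigns to each $\mathbf{A} \in \mathcal{A}^{n \times n}$ a ranking $\succeq^g_{\mathbf{A}}$. The ranking method induced by $EM$ is defined by $i \succeq^{EM}_{\mathbf{A}} j$ iff $w^{EM}_i(\mathbf{A}) \geq w^{EM}_j(\mathbf{A})$. Aggregation: for $\mathbf{A}^{(1)},\dots,\mathbf{A}^{(k)} \in \mathcal{A}^{n \times n}$, $\mathbf{A}^{(1)} \oplus \dots \oplus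 \mathbf{A}^{(k)} \in \mathcal{A}^{n \times n}$ is the entrywise geometric mean, with $(i,j)$ entry $\sqrt[k]{a^{(1)}_{ij} a^{(2)}_{ij} \cdots a^{(k)}_{ij}}$. Group-coherence for choice ($GCC$): a ranking method $g$ on $\mathcal{A}^{n \times n}$ satisfies $GCC$ if for all $k \geq 1$, all $\mathbf{A}^{(1)},\dots,\mathbf{A}^{(k)} \in \mathcal{A}^{n \times n}$ and every alternative $i$ such that $i \succeq^g_{\mathbf{A}^{(\ell)}} j$ for all $1 \leq j \leq n$ and $1 \leq \ell \leq k$, one has $i \succeq^g_{\mathbf{A}^{(1)} \oplus \dots \oplus \mathbf{A}^{(k)}} j$ for all $1 \leq j \leq n$; and furthermore, if there is at least one $\ell$ with $i \succ^g_{\mathbf{A}^{(\ell)}} j$ for all $j \neq i$, then $i \succ^g_{\mathbf{A}^{(1)} \oplus \dots \oplus \mathbf{A}^{(k)}} j$ for all $j \neq i$. *)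

theory Defs
  imports "Jordan_Normal_Form.Spectral_Radius"
begin

text \<open>
  Matrices are the dimension-carrying ones of the Jordan-Normal-Form library, whose entries are
  indexed from 0: the alternatives 1, ..., n are represented by the indices 0, ..., n - 1.
\<close>

definition pairwise_comparison_matrices :: "nat \<Rightarrow> real mat set" where
  "pairwise_comparison_matrices n =
     {A \<in> carrier_mat n n.
        (\<forall>i<n. \<forall>j<n. A $$ (i, j) > 0) \<and>
        (\<forall>i<n. \<forall>j<n. A $$ (j, i) = 1 / A $$ (i, j))}"

text \<open>
  The \<^const>\<open>spectrum\<close> of a real matrix is the set of its real eigenvalues. It is finite for a
  square matrix of positive size, and nonempty (by Perron's theorem) for a positive one; its
  maximum is then the Perron eigenvalue.
\<close>

definition lambda_max :: "real mat \<Rightarrow> real" where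
  "lambda_max A = Max (spectrum A)"

definition is_EM_weight_vector :: "real mat \<Rightarrow> real vec \<Rightarrow> bool" where
  "is_EM_weight_vector A w \<longleftrightarrow>
     w \<in> carrier_vec (dim_row A) \<and>
     (\<forall>i<dim_row A. w $ i > 0) \<and>
     (\<Sum>i<dim_row A. w $ i) = 1 \<and>
     A *\<^sub>v w = lambda_max A \<cdot>\<^sub>v w"

definition EM_weights :: "real mat \<Rightarrow> real vec" where
  "EM_weights A = (THE w. is_EM_weight_vector A w)"

text \<open>
  A relation \<open>r\<close> on the alternatives is read as: \<open>r i j\<close> iff alternative \<open>i\<close> is ranked at least as
  high as alternative \<open>j\<close>. Only its values on indices below \<open>n\<close> matter.
\<close>

definition is_ranking :: "nat \<Rightarrow> (nat \<Rightarrow> nat \<Rightarrow> bool) \<Rightarrow> bool" where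
  "is_ranking n r \<longleftrightarrow>
     (\<forall>i<n. \<forall>j<n. r i j \<or> r j i) \<and>
     (\<forall>i<n. r i i) \<and>
     (\<forall>i<n. \<forall>j<n. \<forall>k<n. r i j \<longrightarrow> r j k \<longrightarrow> r i k)"

definition strict_part :: "(nat \<Rightarrow> nat \<Rightarrow> bool) \<Rightarrow> nat \<Rightarrow> nat \<Rightarrow> bool" where
  "strict_part r i j \<longleftrightarrow> r i j \<and> \<not> r j i"

definition is_ranking_method :: "nat \<Rightarrow> (real mat \<Rightarrow> nat \<Rightarrow> nat \<Rightarrow> bool) \<Rightarrow> bool" where
  "is_ranking_method n g \<longleftrightarrow> (\<forall>A \<in> pairwise_comparison_matrices n. is_ranking n (g A))"

definition EM_ranking :: "real mat \<Rightarrow> nat \<Rightarrow> nat \<Rightarrow> bool" where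
  "EM_ranking A i j \<longleftrightarrow> EM_weights A $ i \<ge> EM_weights A $ j"

lemma EM_ranking_is_ranking_method: "is_ranking_method n EM_ranking"
  by (auto simp: is_ranking_method_def is_ranking_def EM_ranking_def)

definition aggregate :: "nat \<Rightarrow> nat \<Rightarrow> (nat \<Rightarrow> real mat) \<Rightarrow> real mat" where
  "aggregate n k As = mat n n (\<lambda>(i, j). root k (\<Prod>l<k. As l $$ (i, j)))"

lemma aggregate_pairwise_comparison_matrix:
  assumes "k \<ge> 1" and "\<And>l. l < k \<Longrightarrow> As l \<in> pairwise_comparison_matrices n"
  shows "aggregate n k As \<in> pairwise_comparison_matrices n"
proof -
  have pos: "(\<Prod>l<k. As l $$ (i, j)) > 0" if "i < n" "j < n" for i j
  proof (rule prod_pos)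
    fix l assume "l \<in> {..<k}"
    then have "As l \<in> pairwise_comparison_matrices n"
      by (simp add: assms(2))
    then show "As l $$ (i, j) > 0"
      unfolding pairwise_comparison_matrices_def using that by blast
  qed
  have recip_l: "As l $$ (j, i) = 1 / As l $$ (i, j)" if "i < n" "j < n" "l < k" for i j l
    using assms(2)[OF that(3)] that unfolding pairwise_comparison_matrices_def by blast
  have recip: "(\<Prod>l<k. As l $$ (j, i)) = 1 / (\<Prod>l<k. As l $$ (i, j))"
    if "i < n" "j < n" for i j
  proof -
    have "(\<Prod>l<k. As l $$ (j, i)) = (\<Prod>l<k. 1 / As l $$ (i, j))"
      by (rule prod.cong[OF refl], rule recip_l[OF that]) simp
    then show ?thesis
      by (simp only: prod_dividef prod.neutral_const)
  qed
  have "aggregate n k As $$ (i, j) > 0" if "i < n" "j < n" for i j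
    using pos[OF that] that assms(1) by (simp add: aggregate_def)
  moreover have "aggregate n k As $$ (j, i) = 1 / aggregate n k As $$ (i, j)"
    if "i < n" "j < n" for i j
  proof -
    have "aggregate n k As $$ (j, i) = root k (1 / (\<Prod>l<k. As l $$ (i, j)))"
      by (simp only: aggregate_def index_mat(1)[OF that(2) that(1)] case_prod_conv recip[OF that])
    also have "\<dots> = 1 / root k (\<Prod>l<k. As l $$ (i, j))"
      using assms(1) by (simp add: real_root_divide)
    finally show ?thesis
      by (simp only: aggregate_def index_mat(1)[OF that] case_prod_conv)
  qed
  moreover have "aggregate n k As \<in> carrier_mat n n"
    by (simp add: aggregate_def)
  ultimately show ?thesis
    unfolding pairwise_comparison_matrices_def by blast
qed

definition group_coherent_for_choice ::
    "nat \<Rightarrow> (real mat \<Rightarrow> nat \<Rightarrow> nat \<Rightarrow> bool) \<Rightarrow> bool" where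
  "group_coherent_for_choice n g \<longleftrightarrow>
     (\<forall>k\<ge>1. \<forall>As. \<forall>i<n.
        (\<forall>l<k. As l \<in> pairwise_comparison_matrices n) \<longrightarrow>
        (\<forall>l<k. \<forall>j<n. g (As l) i j) \<longrightarrow>
          (\<forall>j<n. g (aggregate n k As) i j) \<and>
          ((\<exists>l<k. \<forall>j<n. j \<noteq> i \<longrightarrow> strict_part (g (As l)) i j) \<longrightarrow>
             (\<forall>j<n. j \<noteq> i \<longrightarrow> strict_part (g (aggregate n k As)) i j)))"

end

theory Submission
  imports Defs
begin

text \<open>
  If all rows of a pairwise comparison matrix have the same sum, then the all-ones vector is a
  positive eigenvector, hence the Perron vector, so all alternatives tie and each of them is a best
  one. The row sums are additive in the entries whereas aggregation is multiplicative, so there is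
  no reason for the aggregate of two such matrices to have constant row sums again; as soon as it
  has not, its Perron vector is not constant, some alternative is no longer best, and
  group-coherence for choice fails.

  The counterexample has \<open>n = 4\<close> and \<open>k = 2\<close>. The matrix \<open>A\<close> has all row sums equal to 5, and \<open>B\<close>
  arises from \<open>A\<close> by exchanging alternatives 0 with 1 and 2 with 3. This choice of \<open>B\<close> makes the
  aggregate invariant under these exchanges, with an explicit Perron vector \<open>(x, x, y, y)\<close>: it has
  two blocks of ones on the diagonal, the block with rows \<open>(c, d)\<close> and \<open>(d, c)\<close> above it and the
  reciprocals of these entries below it, so that the eigenvalue equation reduces to \<open>(x / y)\<^sup>2 = c d\<close>. Here \<open>c d < 1\<close>, so
  that alternative 0 falls behind alternative 2.

  All eigenvectors here are explicit. That a given positive eigenvector is the one defining the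
  Eigenvector Method is the elementary part of Perron's theorem: its eigenvalue is the largest one
  (\<open>positive_eigenvector_lambda_max\<close>), and it spans its eigenspace
  (\<open>positive_eigenvector_unique\<close>).
\<close>

section \<open>Recognising the Perron vector\<close>

lemma mult_mat_vec_index:
  assumes "A \<in> carrier_mat n n" "x \<in> carrier_vec n" "i < n"
  shows "(A *\<^sub>v x) $ i = (\<Sum>j<n. A $$ (i, j) * x $ j)"
  using assms by (auto simp: scalar_prod_def lessThan_atLeast0 intro!: sum.cong)

lemma obtain_max_ratio:
  fixes f v :: "nat \<Rightarrow> real"
  assumes "0 < n" and pos: "\<And>j. j < n \<Longrightarrow> v j > 0"
  obtains k where "k < n" "\<And>j. j < n \<Longrightarrow> f j \<le> f k / v k * v j"
proof -
  let ?R = "(\<lambda>j. f j / v j) ` {..<n}"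
  have "Max ?R \<in> ?R"
    using assms(1) by (intro Max_in) auto
  then obtain k where k: "k < n" "Max ?R = f k / v k"
    by auto
  have "f j \<le> f k / v k * v j" if "j < n" for j
  proof -
    have "f j / v j \<le> f k / v k"
      unfolding k(2)[symmetric] using that by (intro Max_ge) auto
    then show ?thesis
      using pos[OF that] by (simp add: pos_divide_le_eq)
  qed
  with k(1) show ?thesis
    using that by blast
qed

text \<open>
  A positive eigenvector \<open>v\<close> belongs to the largest eigenvalue: for any eigenvector \<open>x\<close>, evaluate the
  eigenvalue equation at an index where \<open>\<bar>x\<^sub>j\<bar> / v\<^sub>j\<close> is largest. This is the row sum bound for the
  spectral radius after the diagonal rescaling that turns \<open>v\<close> into the all-ones vector.
\<close>

lemma positive_eigenvector_lambda_max:
  assumes A: "A \<in> carrier_mat n n" and n: "0 < n"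
    and Apos: "\<And>i j. i < n \<Longrightarrow> j < n \<Longrightarrow> A $$ (i, j) > 0"
    and v: "v \<in> carrier_vec n" and vpos: "\<And>i. i < n \<Longrightarrow> v $ i > 0"
    and eig: "A *\<^sub>v v = s \<cdot>\<^sub>v v"
  shows "lambda_max A = s"
  unfolding lambda_max_def
proof (rule Max_eqI)
  show "finite (spectrum A)"
    using card_finite_spectrum(1)[OF A] .
next
  have "v \<noteq> 0\<^sub>v n"
    using vpos[OF n] n by auto
  then show "s \<in> spectrum A"
    using A v eig unfolding spectrum_def eigenvalue_def eigenvector_def by auto
next
  fix m assume "m \<in> spectrum A"
  then obtain x where x: "x \<in> carrier_vec n" "x \<noteq> 0\<^sub>v n" "A *\<^sub>v x = m \<cdot>\<^sub>v x"
    using A unfolding spectrum_def eigenvalue_def eigenvector_def by auto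
  obtain k where k: "k < n" and le: "\<And>j. j < n \<Longrightarrow> \<bar>x $ j\<bar> \<le> \<bar>x $ k\<bar> / v $ k * v $ j"
    using obtain_max_ratio[of n "\<lambda>j. v $ j" "\<lambda>j. \<bar>x $ j\<bar>"] n vpos by blast
  have xk: "\<bar>x $ k\<bar> > 0"
  proof (rule ccontr)
    assume "\<not> \<bar>x $ k\<bar> > 0"
    then have "x $ j = 0" if "j < n" for j
      using le[OF that] by simp
    then have "x = 0\<^sub>v n"
      using x(1) by (intro eq_vecI) auto
    with x(2) show False ..
  qed
  have "\<bar>m\<bar> * \<bar>x $ k\<bar> = \<bar>\<Sum>j<n. A $$ (k, j) * x $ j\<bar>"
    using mult_mat_vec_index[OF A x(1) k] x(1,3) k by (simp flip: abs_mult)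
  also have "\<dots> \<le> (\<Sum>j<n. \<bar>A $$ (k, j) * x $ j\<bar>)"
    by (rule sum_abs)
  also have "\<dots> \<le> (\<Sum>j<n. A $$ (k, j) * (\<bar>x $ k\<bar> / v $ k * v $ j))"
  proof (rule sum_mono)
    fix j assume "j \<in> {..<n}"
    then show "\<bar>A $$ (k, j) * x $ j\<bar> \<le> A $$ (k, j) * (\<bar>x $ k\<bar> / v $ k * v $ j)"
      using Apos[OF k, of j] le[of j] by (auto simp: abs_mult intro!: mult_left_mono simp del: times_divide_eq_left)
  qed
  also have "\<dots> = \<bar>x $ k\<bar> / v $ k * (\<Sum>j<n. A $$ (k, j) * v $ j)"
    by (simp add: sum_distrib_left mult_ac)
  also have "\<dots> = s * \<bar>x $ k\<bar>"
    using mult_mat_vec_index[OF A v k, symmetric] eig v k vpos[OF k] by simp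
  finally show "m \<le> s"
    using xk by simp
qed

text \<open>
  The Perron eigenspace is a line: with \<open>k\<close> an index that maximises \<open>w\<^sub>k / v\<^sub>k\<close>, the vector
  \<open>(w\<^sub>k / v\<^sub>k) v - w\<close> is nonnegative, lies in the eigenspace and vanishes at \<open>k\<close>. Row \<open>k\<close> of the
  eigenvalue equation then says that a combination of its entries with positive coefficients is
  zero, so that it vanishes everywhere.
\<close>

lemma positive_eigenvector_unique:
  fixes A :: "real mat"
  assumes A: "A \<in> carrier_mat n n" and n: "0 < n"
    and Apos: "\<And>i j. i < n \<Longrightarrow> j < n \<Longrightarrow> A $$ (i, j) > 0"
    and v: "v \<in> carrier_vec n" and vpos: "\<And>i. i < n \<Longrightarrow> v $ i > 0"
    and eig: "A *\<^sub>v v = s \<cdot>\<^sub>v v"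
    and w: "w \<in> carrier_vec n" and weig: "A *\<^sub>v w = s \<cdot>\<^sub>v w"
  obtains c where "w = c \<cdot>\<^sub>v v"
proof -
  obtain k where k: "k < n" and le: "\<And>j. j < n \<Longrightarrow> w $ j \<le> w $ k / v $ k * v $ j"
    using obtain_max_ratio[of n "\<lambda>j. v $ j" "\<lambda>j. w $ j"] n vpos by blast
  define c where "c = w $ k / v $ k"
  have "(\<Sum>j<n. A $$ (k, j) * (c * v $ j - w $ j))
      = c * (\<Sum>j<n. A $$ (k, j) * v $ j) - (\<Sum>j<n. A $$ (k, j) * w $ j)"
    by (simp add: algebra_simps sum_subtractf sum_distrib_left)
  also have "\<dots> = c * (s * v $ k) - s * w $ k"
    using mult_mat_vec_index[OF A v k] mult_mat_vec_index[OF A w k] eig weig v w k by simp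
  also have "\<dots> = 0"
    using vpos[OF k] by (simp add: c_def)
  finally have sum0: "(\<Sum>j<n. A $$ (k, j) * (c * v $ j - w $ j)) = 0" .
  have "A $$ (k, j) * (c * v $ j - w $ j) \<ge> 0" if "j < n" for j
    using Apos[OF k that] le[OF that] by (simp add: c_def)
  then have "A $$ (k, j) * (c * v $ j - w $ j) = 0" if "j < n" for j
    using sum0 that by (subst (asm) sum_nonneg_eq_0_iff) auto
  then have "w $ j = c * v $ j" if "j < n" for j
    using Apos[OF k that] that by fastforce
  then have "w = c \<cdot>\<^sub>v v"
    using v w by (intro eq_vecI) auto
  then show ?thesis
    using that by blast
qed

text \<open>
  The sum of the entries pins down the scaling, so that a positive eigenvector determines the
  weights completely.
\<close>

lemma positive_eigenvector_EM_weights: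
  assumes A: "A \<in> carrier_mat n n" and n: "0 < n"
    and Apos: "\<And>i j. i < n \<Longrightarrow> j < n \<Longrightarrow> A $$ (i, j) > 0"
    and v: "v \<in> carrier_vec n" and vpos: "\<And>i. i < n \<Longrightarrow> v $ i > 0"
    and eig: "A *\<^sub>v v = s \<cdot>\<^sub>v v"
  shows "EM_weights A = (1 / (\<Sum>i<n. v $ i)) \<cdot>\<^sub>v v"
proof -
  have lam: "lambda_max A = s"
    by (rule positive_eigenvector_lambda_max[OF assms])
  have row: "dim_row A = n"
    using A by simp
  define S where "S = (\<Sum>i<n. v $ i)"
  have S: "S > 0"
    unfolding S_def using n vpos by (intro sum_pos) auto
  show ?thesis
    unfolding EM_weights_def S_def[symmetric]
  proof (rule the_equality)
    have "(\<Sum>i<n. 1 / S * v $ i) = 1"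
      using S by (simp only: sum_distrib_left[symmetric] S_def[symmetric]) simp
    moreover have "A *\<^sub>v ((1 / S) \<cdot>\<^sub>v v) = s \<cdot>\<^sub>v ((1 / S) \<cdot>\<^sub>v v)"
      using eig mult_mat_vec[OF A v, of "1 / S"] by (simp add: smult_smult_assoc mult.commute)
    ultimately show "is_EM_weight_vector A ((1 / S) \<cdot>\<^sub>v v)"
      using S v vpos unfolding is_EM_weight_vector_def row lam by auto
  next
    fix w assume "is_EM_weight_vector A w"
    then have w: "w \<in> carrier_vec n" "A *\<^sub>v w = s \<cdot>\<^sub>v w" "(\<Sum>i<n. w $ i) = 1"
      unfolding is_EM_weight_vector_def row lam by auto
    obtain c where c: "w = c \<cdot>\<^sub>v v"
      using positive_eigenvector_unique[OF assms w(1,2)] .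
    have "c * S = 1"
      using w(3) v unfolding c S_def by (simp add: sum_distrib_left)
    then have "c = 1 / S"
      using S by (simp add: field_simps)
    then show "w = (1 / S) \<cdot>\<^sub>v v"
      using c by simp
  qed
qed

lemma positive_eigenvector_EM_ranking:
  assumes A: "A \<in> carrier_mat n n"
    and Apos: "\<And>i j. i < n \<Longrightarrow> j < n \<Longrightarrow> A $$ (i, j) > 0"
    and v: "v \<in> carrier_vec n" and vpos: "\<And>i. i < n \<Longrightarrow> v $ i > 0"
    and eig: "A *\<^sub>v v = s \<cdot>\<^sub>v v"
    and ij: "i < n" "j < n"
  shows "EM_ranking A i j \<longleftrightarrow> v $ i \<ge> v $ j"
proof -
  have n: "0 < n"
    using ij by simp
  have S: "(\<Sum>i<n. v $ i) > 0"
    using n vpos by (intro sum_pos) auto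
  have "EM_weights A = (1 / (\<Sum>i<n. v $ i)) \<cdot>\<^sub>v v"
    by (rule positive_eigenvector_EM_weights[OF A n Apos v vpos eig])
  then show ?thesis
    using S v ij unfolding EM_ranking_def by (simp add: divide_le_cancel)
qed

text \<open>The all-ones vector is the Perron vector when the row sums are constant.\<close>

lemma constant_row_sums_EM_ranking:
  assumes A: "A \<in> pairwise_comparison_matrices n"
    and rows: "\<And>i. i < n \<Longrightarrow> (\<Sum>j<n. A $$ (i, j)) = s"
    and ij: "i < n" "j < n"
  shows "EM_ranking A i j"
proof -
  have carrier: "A \<in> carrier_mat n n"
    and pos: "\<And>i j. i < n \<Longrightarrow> j < n \<Longrightarrow> A $$ (i, j) > 0"
    using A unfolding pairwise_comparison_matrices_def by blast+
  define v :: "real vec" where "v = vec n (\<lambda>_. 1)"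
  have v: "v \<in> carrier_vec n"
    by (simp add: v_def)
  have "(A *\<^sub>v v) $ i = (s \<cdot>\<^sub>v v) $ i" if "i < n" for i
    using mult_mat_vec_index[OF carrier v that] rows[OF that] that by (simp add: v_def)
  then have "A *\<^sub>v v = s \<cdot>\<^sub>v v"
    using carrier v by (intro eq_vecI) auto
  then have "EM_ranking A i j \<longleftrightarrow> v $ i \<ge> v $ j"
    using positive_eigenvector_EM_ranking[OF carrier pos v _ _ ij] by (simp add: v_def)
  then show ?thesis
    using ij by (simp add: v_def)
qed

section \<open>The counterexample\<close>

lemma all_less_4: "(\<forall>i<4. P i) \<longleftrightarrow> P 0 \<and> P 1 \<and> P 2 \<and> P (3::nat)"
  by (auto simp: less_Suc_eq numeral_eq_Suc)

lemma sum_less_4: "(\<Sum>j<4. f j) = f 0 + f 1 + f 2 + (f (3::nat) :: real)"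
  by (simp add: numeral_eq_Suc)

definition mat4 :: "real list list \<Rightarrow> real mat" where
  "mat4 rs = mat 4 4 (\<lambda>(i, j). rs ! i ! j)"

lemma mat4_carrier: "mat4 rs \<in> carrier_mat 4 4"
  by (simp add: mat4_def)

lemma mat4_index: "i < 4 \<Longrightarrow> j < 4 \<Longrightarrow> mat4 rs $$ (i, j) = rs ! i ! j"
  by (simp add: mat4_def)

text \<open>
  Apart from the constant row sums, what matters is that the product of the entries of the upper
  right block, which is \<open>(c d)\<^sup>2\<close> for the aggregate below, differs from 1.
\<close>

definition A_rows :: "real list list" where
  "A_rows = [[1, 1/3, 4/3, 7/3], [3, 1, 2/3, 1/3], [3/4, 3/2, 1, 7/4], [3/7, 3, 4/7, 1]]"

text \<open>The same preferences after exchanging alternatives 0 with 1 and 2 with 3.\<close>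

definition B_rows :: "real list list" where
  "B_rows = [[1, 3, 1/3, 2/3], [1/3, 1, 7/3, 4/3], [3, 3/7, 1, 4/7], [3/2, 3/4, 7/4, 1]]"

lemma A_pairwise_comparison: "mat4 A_rows \<in> pairwise_comparison_matrices 4"
  unfolding pairwise_comparison_matrices_def all_less_4
  by (simp add: mat4_carrier mat4_index A_rows_def)

lemma B_pairwise_comparison: "mat4 B_rows \<in> pairwise_comparison_matrices 4"
  unfolding pairwise_comparison_matrices_def all_less_4
  by (simp add: mat4_carrier mat4_index B_rows_def)

lemma A_row_sums: "\<forall>i<4. (\<Sum>j<4. mat4 A_rows $$ (i, j)) = 5"
  unfolding all_less_4 sum_less_4 by (simp add: mat4_index A_rows_def)

lemma B_row_sums: "\<forall>i<4. (\<Sum>j<4. mat4 B_rows $$ (i, j)) = 5"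
  unfolding all_less_4 sum_less_4 by (simp add: mat4_index B_rows_def)

text \<open>
  The blocks of ones come from the exchanged pairs: each such entry is the geometric mean of a
  number and its reciprocal.
\<close>

lemma aggregate_A_B:
  assumes "As 0 = mat4 A_rows" "As 1 = mat4 B_rows"
    and "c = 2 / 3" "d = sqrt 14 / 3"
  shows "aggregate 4 2 As =
    mat4 [[1, 1, c, d], [1, 1, d, c], [1/c, 1/d, 1, 1], [1/d, 1/c, 1, 1]]" (is "_ = ?C")
proof -
  have prod2: "(\<Prod>l<2. f l) = f 0 * (f 1 :: real)" for f :: "nat \<Rightarrow> real"
    by (simp add: numeral_eq_Suc)
  have agg: "aggregate 4 2 As $$ (i, j) = sqrt (A_rows ! i ! j * B_rows ! i ! j)"
    if "i < 4" "j < 4" for i j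
    using that assms(1,2) by (simp add: aggregate_def prod2 mat4_index sqrt_def)
  have sqrts: "sqrt (4/9) = 2/3" "sqrt (14/9) = sqrt 14 / 3"
    "sqrt (9/4) = 3/2" "sqrt (9/14) = 3 / sqrt 14"
    by (simp_all add: real_sqrt_divide)
  have "\<forall>i<4. \<forall>j<4. aggregate 4 2 As $$ (i, j) = ?C $$ (i, j)"
    unfolding all_less_4
    by (simp add: agg mat4_index A_rows_def B_rows_def assms(3,4) sqrts)
  then show ?thesis
    by (intro eq_matI) (simp_all add: aggregate_def mat4_def)
qed

text \<open>
  On vectors \<open>(x, x, y, y)\<close> the matrix acts by the 2 by 2 matrix with rows \<open>(2, c + d)\<close> and
  \<open>((c + d) / (c d), 2)\<close>. Its Perron vector is \<open>(\<surd>(c d), 1)\<close>, with eigenvalue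
  \<open>2 + (c + d) / \<surd>(c d)\<close>.
\<close>

lemma block_matrix_EM_ranking:
  fixes c d :: real
  assumes c: "c > 0" and d: "d > 0" and cd: "c * d < 1"
  shows "\<not> EM_ranking (mat4 [[1, 1, c, d], [1, 1, d, c], [1/c, 1/d, 1, 1], [1/d, 1/c, 1, 1]]) 0 2"
    (is "\<not> EM_ranking ?C 0 2")
proof -
  define x where "x = sqrt (c * d)"
  have x: "x > 0" "x < 1"
    using c d cd by (simp_all add: x_def)
  have xx: "x * x = c * d"
    using c d by (simp add: x_def)
  define v where "v = vec 4 (\<lambda>i. [x, x, 1, 1] ! i)"
  have v: "v \<in> carrier_vec 4"
    by (simp add: v_def)
  have v_index: "v $ i = [x, x, 1, 1] ! i" if "i < 4" for i
    using that by (simp add: v_def)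
  have upper: "2 * x + (c + d) = (2 + (c + d) / x) * x"
    using x by (simp add: field_simps)
  have "x / c + x / d = x * (c + d) / (c * d)"
    using c d by (simp add: field_simps)
  also have "\<dots> = (c + d) / x"
    using x by (simp add: xx[symmetric])
  finally have lower: "x / c + x / d = (c + d) / x" .
  have "\<forall>i<4. (?C *\<^sub>v v) $ i = (2 + (c + d) / x) * v $ i"
    unfolding all_less_4
    using upper lower
    by (simp add: mult_mat_vec_index[OF mat4_carrier v] sum_less_4 mat4_index v_index)
  then have eig: "?C *\<^sub>v v = (2 + (c + d) / x) \<cdot>\<^sub>v v"
    using v mat4_carrier by (intro eq_vecI) (auto simp: mat4_def)
  have "\<forall>i<4. \<forall>j<4. ?C $$ (i, j) > 0"
    unfolding all_less_4 using c d by (simp add: mat4_index)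
  moreover have "\<forall>i<4. v $ i > 0"
    unfolding all_less_4 using x by (simp add: v_index)
  ultimately have "EM_ranking ?C 0 2 \<longleftrightarrow> v $ 0 \<ge> v $ 2"
    using positive_eigenvector_EM_ranking[OF mat4_carrier _ v _ eig] by simp
  then show ?thesis
    using x by (simp add: v_index)
qed

theorem corollary4p1:
  shows "\<exists>n::nat. n \<ge> 1 \<and> \<not> group_coherent_for_choice n EM_ranking"
proof (intro exI[of _ 4] conjI notI)
  show "(1::nat) \<le> 4"
    by simp
next
  assume coherent: "group_coherent_for_choice 4 EM_ranking"
  define As where "As l = (if l = 0 then mat4 A_rows else mat4 B_rows)" for l :: nat
  have pcm: "\<forall>l<2. As l \<in> pairwise_comparison_matrices 4"
    using A_pairwise_comparison B_pairwise_comparison by (simp add: As_def)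
  have best: "\<forall>l<2. \<forall>j<4. EM_ranking (As l) 0 j"
  proof (intro allI impI)
    fix l j :: nat assume "l < 2" "j < 4"
    then show "EM_ranking (As l) 0 j"
      using pcm A_row_sums B_row_sums
      by (intro constant_row_sums_EM_ranking[where n = 4 and s = 5]) (auto simp: As_def)
  qed
  have "(1::nat) \<le> 2" "(0::nat) < 4"
    by simp_all
  then have "\<forall>j<4. EM_ranking (aggregate 4 2 As) 0 j"
    using coherent pcm best unfolding group_coherent_for_choice_def by blast
  then have "EM_ranking (aggregate 4 2 As) 0 2"
    by simp
  moreover have "\<not> EM_ranking (aggregate 4 2 As) 0 2"
  proof -
    \<comment> \<open>The inequality \<open>c d < 1\<close> amounts to \<open>56 < 81\<close>.\<close>
    have "sqrt 14 < 9 / 2"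
      by (rule real_less_lsqrt) (simp_all add: power2_eq_square)
    then have "2 / 3 * (sqrt 14 / 3) < 1"
      by simp
    moreover have "As 0 = mat4 A_rows" "As 1 = mat4 B_rows"
      by (simp_all add: As_def)
    ultimately show ?thesis
      using aggregate_A_B[OF _ _ refl refl] block_matrix_EM_ranking[of "2 / 3" "sqrt 14 / 3"] by simp
  qed
  ultimately show False
    by contradiction
qed

end
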